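(* Let $\Bbbk$ be a field and let $b\in\Bbbk$, $b\neq 0$, with $b^2\neq 1$. Let $V_{1b1}$ be the braided vector space with basis $v_1,v_2$ and braiding $c(v_1\otimes v_1)=v_2\otimes v_2$, $c(v_1\otimes v_2)=b\,v_1\otimes v_2$, $c(v_2\otimes v_1)=b\,v_2\otimes v_1$, $c(v_2\otimes v_2)=v_1\otimes v_1$. Then the Nichols algebra $\mathfrak{B}(V_{1b1})$ satisfies $\dim_{\Bbbk}\mathfrak{B}(V_{1b1})<\infty$ if and only if $b$ is a primitive $n$-th root of unity for some $n\geq 2$. In that case $\dim_{\Bbbk}\mathfrak{B}(V_{1b1})=n^2$.
   Context: For a braided vector space $(V,c)$, let $c_i$ be the endomorphism of $V^{\otimes n}$ acting as $c$ on the tensor factors $i,i+1$ and as the identity elsewhere. Define $\mathfrak{S}_{n,1}=\mathrm{id}+c_n+c_{n-1}c_n+\cdots+c_1\cdots c_{n-1}c_n\in\mathrm{End}(V^{\otimes(n+1)})$, $\mathfrak{S}_1=\mathrm{id}$, and $\mathfrak{S}_n=\mathfrak{S}_{n-1,1}(\mathfrak{S}_{n-1}\otimes\mathrm{id})\in\mathrm{End}(V^{\otimes n})$ (so $\mathfrak{S}_2=\mathrm{id}+c$). The Nichols algebra of $(V,c)$ is the graded algebra $\mathfrak{B}(V)=\Bbbk\oplus V\oplus\bigoplus_{n\geq 2}V^{\otimes n}/\ker\mathfrak{S}_n$, a quotient of the tensor algebra $T(V)$. *)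

theory Defs
  imports "HOL-Library.Poly_Mapping" "HOL-Algebra.Algebraic_Closure_Type"
    "HOL-Algebra.Embedded_Algebras"
begin

section \<open>The tensor algebra of a vector space with a basis\<close>

text \<open>
  A vector space \<open>V\<close> over \<open>'k\<close> is given by a basis, the elements of the type \<open>'x\<close>.  Then the words
  of length \<open>n\<close> over \<open>'x\<close> are a basis of the \<open>n\<close>-th tensor power of \<open>V\<close>, the word \<open>[x, y]\<close> standing
  for the tensor of \<open>x\<close> and \<open>y\<close>, and the tensor algebra is the type \<open>'x list \<Rightarrow>\<^sub>0 'k\<close>.  With words as
  an additively written monoid under concatenation, the product that \<^theory>\<open>HOL-Library.Poly_Mapping\<close>
  provides (convolution) is the product of the tensor algebra.
\<close>

instantiation list :: (type) monoid_add
begin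
definition zero_list :: "'a list" where "zero_list = []"
definition plus_list :: "'a list \<Rightarrow> 'a list \<Rightarrow> 'a list" where "plus_list u v = u @ v"
instance by standard (simp_all add: zero_list_def plus_list_def)
end

definition scalar :: "'k \<Rightarrow> ('x list \<Rightarrow>\<^sub>0 'k::field)"
  where "scalar a = Poly_Mapping.single [] a"

definition word :: "'x list \<Rightarrow> ('x list \<Rightarrow>\<^sub>0 'k::field)"
  where "word w = Poly_Mapping.single w 1"

definition lin_ext ::
    "('x list \<Rightarrow> ('x list \<Rightarrow>\<^sub>0 'k)) \<Rightarrow> ('x list \<Rightarrow>\<^sub>0 'k::field) \<Rightarrow> ('x list \<Rightarrow>\<^sub>0 'k)"
  where "lin_ext f p = (\<Sum>w\<in>Poly_Mapping.keys p. scalar (Poly_Mapping.lookup p w) * f w)"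

definition tensor_power :: "nat \<Rightarrow> ('x list \<Rightarrow>\<^sub>0 'k::field) set"
  where "tensor_power n = {p. \<forall>w\<in>Poly_Mapping.keys p. length w = n}"

definition homog_part :: "nat \<Rightarrow> ('x list \<Rightarrow>\<^sub>0 'k::field) \<Rightarrow> ('x list \<Rightarrow>\<^sub>0 'k)"
  where "homog_part n = lin_ext (\<lambda>w. if length w = n then word w else 0)"

section \<open>Braided vector spaces\<close>

text \<open>
  A braiding is given by its values on the basis of the tensor square: \<open>c x y\<close> is the image of the
  tensor of \<open>x\<close> and \<open>y\<close>.  The endomorphism \<open>braid_at c i\<close> is the \<open>c\<^sub>i\<close> acting on the factors \<open>i\<close> and
  \<open>i + 1\<close>, counted from 1; it is meaningful only on words of length at least \<open>i + 1\<close>.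
\<close>

type_synonym ('x, 'k) braiding = "'x \<Rightarrow> 'x \<Rightarrow> ('x list \<Rightarrow>\<^sub>0 'k)"

definition braid_at ::
    "('x, 'k::field) braiding \<Rightarrow> nat \<Rightarrow> ('x list \<Rightarrow>\<^sub>0 'k) \<Rightarrow> ('x list \<Rightarrow>\<^sub>0 'k)"
  where "braid_at c i =
    lin_ext (\<lambda>w. word (take (i - 1) w) * c (w ! (i - 1)) (w ! i) * word (drop (i + 1) w))"

definition braided_vector_space :: "('x, 'k::field) braiding \<Rightarrow> bool"
  where "braided_vector_space c \<longleftrightarrow>
    bij_betw (braid_at c 1) (tensor_power 2) (tensor_power 2) \<and>
    (\<forall>p\<in>tensor_power 3. braid_at c 1 (braid_at c 2 (braid_at c 1 p)) =
                         braid_at c 2 (braid_at c 1 (braid_at c 2 p)))"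

section \<open>Quantum symmetrizers and the Nichols algebra\<close>

text \<open>
  \<open>qsym_step c n\<close> is \<open>\<SS>\<^sub>n\<^sub>,\<^sub>1\<close>, meaningful on the tensor power of degree \<open>n + 1\<close>; the summand for \<open>i\<close> is
  the composition \<open>c\<^sub>i c\<^sub>i\<^sub>+\<^sub>1 \<dots> c\<^sub>n\<close>, so \<open>c\<^sub>n\<close> is applied first.
\<close>

definition qsym_step ::
    "('x, 'k::field) braiding \<Rightarrow> nat \<Rightarrow> ('x list \<Rightarrow>\<^sub>0 'k) \<Rightarrow> ('x list \<Rightarrow>\<^sub>0 'k)"
  where "qsym_step c n p = p + (\<Sum>i = 1..n. foldr (braid_at c) [i..<Suc n] p)"

text \<open>The tensor product of \<open>F\<close> with the identity of \<open>V\<close>, meaningful in positive degrees.\<close>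

definition tensor_id ::
    "(('x list \<Rightarrow>\<^sub>0 'k::field) \<Rightarrow> ('x list \<Rightarrow>\<^sub>0 'k)) \<Rightarrow> ('x list \<Rightarrow>\<^sub>0 'k) \<Rightarrow> ('x list \<Rightarrow>\<^sub>0 'k)"
  where "tensor_id F = lin_ext (\<lambda>w. F (word (butlast w)) * word [last w])"

text \<open>The value at 0 makes the degree 0 part of the Nichols algebra the ground field.\<close>

fun qsym :: "('x, 'k::field) braiding \<Rightarrow> nat \<Rightarrow> ('x list \<Rightarrow>\<^sub>0 'k) \<Rightarrow> ('x list \<Rightarrow>\<^sub>0 'k)"
  where
    "qsym c 0 = id"
  | "qsym c (Suc 0) = id"
  | "qsym c (Suc (Suc n)) = qsym_step c (Suc n) \<circ> tensor_id (qsym c (Suc n))"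

text \<open>
  The direct sum over \<open>n\<close> of the kernels of \<open>\<SS>\<^sub>n\<close> on the tensor powers of degree \<open>n\<close>.  It is a
  two-sided ideal of the tensor algebra when \<open>c\<close> satisfies the braid equation.
\<close>

definition nichols_ideal :: "('x, 'k::field) braiding \<Rightarrow> ('x list \<Rightarrow>\<^sub>0 'k) set"
  where "nichols_ideal c = {p. \<forall>n. qsym c n (homog_part n p) = 0}"

definition nichols_algebra :: "('x, 'k::field) braiding \<Rightarrow> ('x list \<Rightarrow>\<^sub>0 'k) set ring"
  where "nichols_algebra c = ring_of_type_algebra Quot nichols_ideal c"

text \<open>The copy of the ground field in the Nichols algebra.\<close>

definition nichols_scalars :: "('x, 'k::field) braiding \<Rightarrow> ('x list \<Rightarrow>\<^sub>0 'k) set set"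
  where "nichols_scalars c =
    range (\<lambda>a. nichols_ideal c +>\<^bsub>ring_of_type_algebra\<^esub> scalar a)"

section \<open>The braiding of the theorem and roots of unity\<close>

datatype gen = V1 | V2

fun braiding_1b1 :: "'k::field \<Rightarrow> (gen, 'k) braiding"
  where
    "braiding_1b1 b V1 V1 = word [V2, V2]"
  | "braiding_1b1 b V1 V2 = scalar b * word [V1, V2]"
  | "braiding_1b1 b V2 V1 = scalar b * word [V2, V1]"
  | "braiding_1b1 b V2 V2 = word [V1, V1]"

definition primitive_root_of_unity :: "nat \<Rightarrow> 'k::field \<Rightarrow> bool"
  where "primitive_root_of_unity n z \<longleftrightarrow>
    n > 0 \<and> z ^ n = 1 \<and> (\<forall>m. 0 < m \<and> m < n \<longrightarrow> z ^ m \<noteq> 1)"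

section \<open>Consistency of the encoding\<close>

lemma ring_tensor_algebra: "ring (ring_of_type_algebra :: ('x list \<Rightarrow>\<^sub>0 'k::field) ring)"
proof -
  have "\<exists>y. x + y = 0" for x :: "'x list \<Rightarrow>\<^sub>0 'k"
    using add.right_inverse by blast
  then show ?thesis
    unfolding ring_of_type_algebra_def
    by unfold_locales (auto simp: algebra_simps Units_def)
qed

lemma word_mult: "word u * word v = word (u @ v)"
  by (simp add: word_def mult_single plus_list_def)

lemma scalar_mult: "scalar a * scalar b = scalar (a * b)"
  by (simp add: scalar_def mult_single plus_list_def)

lemma scalar_1 [simp]: "scalar 1 = 1"
  unfolding scalar_def zero_list_def[symmetric] by (simp add: single_one)

lemma scalar_0 [simp]: "scalar 0 = 0"
  by (simp add: scalar_def)

lemma scalar_add: "scalar (a + b) = scalar a + scalar b"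
  by (simp add: scalar_def single_add)

lemma scalar_word: "scalar a * word w = Poly_Mapping.single w a"
  by (simp add: scalar_def word_def mult_single plus_list_def)

lemma word_scalar: "word w * scalar a = scalar a * word w"
  by (simp add: scalar_def word_def mult_single plus_list_def)

lemma lin_ext_superset:
  assumes "finite A" "Poly_Mapping.keys p \<subseteq> A"
  shows "lin_ext f p = (\<Sum>w\<in>A. scalar (Poly_Mapping.lookup p w) * f w)"
  unfolding lin_ext_def
  by (rule sum.mono_neutral_left) (use assms in \<open>auto simp: in_keys_iff\<close>)

lemma lin_ext_0 [simp]: "lin_ext f 0 = 0"
  by (simp add: lin_ext_def)

lemma lin_ext_add: "lin_ext f (p + q) = lin_ext f p + lin_ext f q"
proof -
  let ?A = "Poly_Mapping.keys p \<union> Poly_Mapping.keys q"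
  have "Poly_Mapping.keys (p + q) \<subseteq> ?A" by (rule Poly_Mapping.keys_add)
  then show ?thesis
    by (simp add: lin_ext_superset[of ?A] lookup_add scalar_add distrib_right sum.distrib)
qed

lemma lin_ext_sum: "lin_ext f (sum g A) = (\<Sum>i\<in>A. lin_ext f (g i))"
  by (induction A rule: infinite_finite_induct) (simp_all add: lin_ext_add)

lemma lin_ext_single: "lin_ext f (Poly_Mapping.single w a) = scalar a * f w"
  by (cases "a = 0") (simp_all add: lin_ext_def)

lemma lin_ext_word: "lin_ext f (word w) = f w"
  by (simp add: word_def lin_ext_single)

lemma lin_ext_scalar_word: "lin_ext f (scalar a * word w) = scalar a * f w"
  by (simp add: scalar_word lin_ext_single)

lemma lin_ext_ident: "lin_ext word p = p"
proof (rule poly_mapping_eqI)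
  fix w
  show "Poly_Mapping.lookup (lin_ext word p) w = Poly_Mapping.lookup p w"
    by (simp add: lin_ext_def lookup_sum scalar_word lookup_single when_def in_keys_iff)
qed

lemma lin_ext_scalar: "lin_ext f (scalar a * p) = scalar a * lin_ext f p"
proof -
  have "scalar a * p =
      (\<Sum>w\<in>Poly_Mapping.keys p. scalar (a * Poly_Mapping.lookup p w) * word w)"
    by (subst (1) lin_ext_ident[symmetric])
      (simp add: lin_ext_def sum_distrib_left scalar_mult[symmetric] mult.assoc)
  then show ?thesis
    by (simp add: lin_ext_sum lin_ext_scalar_word)
      (simp add: lin_ext_def sum_distrib_left scalar_mult[symmetric] mult.assoc)
qed

lemma lin_ext_lin_ext: "lin_ext f (lin_ext g p) = lin_ext (\<lambda>w. lin_ext f (g w)) p"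
  by (simp add: lin_ext_def[of g] lin_ext_sum lin_ext_scalar)
     (simp add: lin_ext_def)

lemma lin_ext_cong:
  "(\<And>w. w \<in> Poly_Mapping.keys p \<Longrightarrow> f w = g w) \<Longrightarrow> lin_ext f p = lin_ext g p"
  by (simp add: lin_ext_def)

lemma length_2_cases:
  assumes "length w = 2" obtains x y where "w = [x, y]"
  using assms by (auto simp: length_Suc_conv numeral_2_eq_2)

lemma length_3_cases:
  assumes "length w = 3" obtains x y z where "w = [x, y, z]"
  using assms by (auto simp: length_Suc_conv numeral_3_eq_3)

lemma word_Nil [simp]: "word [] = 1"
  using scalar_1 by (simp add: scalar_def word_def)

lemma word_left_scalar: "word w * (scalar a * p) = scalar a * (word w * p)"
  by (simp add: mult.assoc[symmetric] word_scalar)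

lemma word_left_word: "word u * (word v * p) = word (u @ v) * p"
  by (simp add: mult.assoc[symmetric] word_mult)

lemma scalar_left_scalar: "scalar a * (scalar b * p) = scalar (a * b) * p"
  by (simp add: mult.assoc[symmetric] scalar_mult)

lemmas braid_simps = braid_at_def lin_ext_word lin_ext_scalar word_mult scalar_mult
  word_left_scalar word_left_word scalar_left_scalar mult.assoc

lemma braid_at_1b1_inverse:
  assumes "b \<noteq> 0" "p \<in> tensor_power 2"
  shows "braid_at (braiding_1b1 (inverse b)) 1 (braid_at (braiding_1b1 b) 1 p) = p"
proof -
  have "lin_ext (\<lambda>w. braid_at (braiding_1b1 (inverse b)) 1
      (word (take 0 w) * braiding_1b1 b (w ! 0) (w ! 1) * word (drop 2 w))) p = lin_ext word p"
  proof (rule lin_ext_cong)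
    fix w assume "w \<in> Poly_Mapping.keys p"
    with assms(2) have "length w = 2" by (auto simp: tensor_power_def)
    then obtain x y where "w = [x, y]" by (rule length_2_cases)
    then show "braid_at (braiding_1b1 (inverse b)) 1
      (word (take 0 w) * braiding_1b1 b (w ! 0) (w ! 1) * word (drop 2 w)) = word w"
      using assms(1) by (cases x; cases y)
        (simp_all add: braid_simps)
  qed
  then show ?thesis
    by (simp add: braid_at_def lin_ext_lin_ext lin_ext_ident numeral_2_eq_2)
qed

lemma tensor_power_lin_ext:
  assumes "p \<in> tensor_power n" "\<And>w. length w = n \<Longrightarrow> f w \<in> tensor_power m"
  shows "lin_ext f p \<in> tensor_power m"
proof -
  have smult: "scalar a * q \<in> tensor_power m"
    if q: "q \<in> tensor_power m" for a and q :: "'a list \<Rightarrow>\<^sub>0 'b"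
    unfolding tensor_power_def
  proof (intro CollectI ballI)
    fix w assume "w \<in> Poly_Mapping.keys (scalar a * q)"
    then obtain u v where "u \<in> Poly_Mapping.keys (scalar a)" "v \<in> Poly_Mapping.keys q" "w = u + v"
      using keys_mult[of "scalar a" q] by blast
    then show "length w = m"
      using q by (auto simp: scalar_def plus_list_def tensor_power_def split: if_splits)
  qed
  have sum: "sum g A \<in> tensor_power m" if "\<And>w. w \<in> A \<Longrightarrow> g w \<in> tensor_power m" "finite A"
    for A and g :: "'a list \<Rightarrow> ('a list \<Rightarrow>\<^sub>0 'b)"
    using that(2,1)
  proof (induction A rule: finite_induct)
    case empty
    show ?case by (simp add: tensor_power_def)
  next
    case (insert x A)
    then have "g x \<in> tensor_power m" "sum g A \<in> tensor_power m" by auto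
    then show ?case
      using insert.hyps Poly_Mapping.keys_add[of "g x" "sum g A"]
      by (fastforce simp: tensor_power_def)
  qed
  show ?thesis
    unfolding lin_ext_def
  proof (rule sum)
    fix w assume "w \<in> Poly_Mapping.keys p"
    with assms(1) have "length w = n" by (simp add: tensor_power_def)
    from smult[OF assms(2)[OF this]]
    show "scalar (Poly_Mapping.lookup p w) * f w \<in> tensor_power m" .
  qed simp
qed

lemma braid_at_1b1_tensor_power:
  assumes "p \<in> tensor_power 2"
  shows "braid_at (braiding_1b1 b) 1 p \<in> tensor_power 2"
  unfolding braid_at_def
proof (rule tensor_power_lin_ext[OF assms])
  fix w :: "gen list" assume "length w = 2"
  then obtain x y where w: "w = [x, y]" by (rule length_2_cases)
  have single: "scalar a * word [u, v] \<in> tensor_power 2" for u v :: gen and a :: 'a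
    by (simp add: tensor_power_def scalar_word)
  have "braiding_1b1 b x y \<in> tensor_power 2"
    using single[of 1] by (cases x; cases y) (simp_all add: single)
  then show "word (take (1 - 1) w) * braiding_1b1 b (w ! (1 - 1)) (w ! 1) * word (drop (1 + 1) w)
      \<in> tensor_power 2"
    by (simp add: w)
qed

lemma braided_vector_space_1b1:
  assumes "b \<noteq> 0"
  shows "braided_vector_space (braiding_1b1 b)"
  unfolding braided_vector_space_def
proof (intro conjI ballI)
  show "bij_betw (braid_at (braiding_1b1 b) 1) (tensor_power 2) (tensor_power 2)"
  proof (rule bij_betw_byWitness[where f' = "braid_at (braiding_1b1 (inverse b)) 1"])
    show "\<forall>p\<in>tensor_power 2. braid_at (braiding_1b1 b) 1 (braid_at (braiding_1b1 (inverse b)) 1 p) = p"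
      using braid_at_1b1_inverse[of "inverse b"] assms by simp
  qed (use assms braid_at_1b1_inverse braid_at_1b1_tensor_power in blast)+
next
  fix p :: "gen list \<Rightarrow>\<^sub>0 'a" assume p: "p \<in> tensor_power 3"
  let ?c = "braid_at (braiding_1b1 b)"
  have three: "?c i (?c j (?c k p)) = lin_ext (\<lambda>w. ?c i (?c j (?c k (word w)))) p" for i j k
    by (subst (2 3 4) braid_at_def) (simp add: lin_ext_lin_ext braid_at_def lin_ext_word)
  show "?c 1 (?c 2 (?c 1 p)) = ?c 2 (?c 1 (?c 2 p))"
    unfolding three
  proof (rule lin_ext_cong)
    fix w assume "w \<in> Poly_Mapping.keys p"
    with p have "length w = 3" by (auto simp: tensor_power_def)
    then obtain x y z where "w = [x, y, z]" by (rule length_3_cases)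
    then show "?c 1 (?c 2 (?c 1 (word w))) = ?c 2 (?c 1 (?c 2 (word w)))"
      by (cases x; cases y; cases z)
        (simp_all add: braid_simps)
  qed
qed

end

theory Submission
  imports Defs "HOL-Library.Multiset"
begin

text \<open>
  Write \<open>\<sigma>\<close> for the swap of the two basis vectors.  The braiding is
  \<open>c(v\<^sub>s \<otimes> v\<^sub>t) = q v\<^sub>\<sigma>\<^sub>t \<otimes> v\<^sub>\<sigma>\<^sub>s\<close> with \<open>q = 1\<close> if \<open>s = t\<close> and \<open>q = b\<close> otherwise: up to the two
  occurrences of \<open>\<sigma>\<close> it permutes the tensor factors.  These occurrences can be removed on all tensor
  powers at once.  Relabel the letter at position \<open>p\<close> of a word (counted from 0) by \<open>\<sigma>\<^sup>p\<close>.  A letter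
  that moves by one position under \<open>c\<^sub>i\<close> is hit by \<open>\<sigma>\<close> once, and so its new label is its old one; and
  neighbouring letters are equal exactly when their labels differ.  In terms of labels, \<open>c\<close> is
  therefore the diagonal braiding that exchanges two labels, with factor \<open>b\<close> if they are equal and 1
  otherwise.  This is the braiding of a quantum plane, whose Nichols algebra is
  \<open>\<Bbbk>[x]/(x\<^sup>n) \<otimes> \<Bbbk>[y]/(y\<^sup>n)\<close> when \<open>b\<close> is a primitive \<open>n\<close>-th root of unity.

  In terms of labels the quantum symmetrizer is explicit.  Call the multiset of labels of a word
  its content (\<open>letter_content\<close>).  Inserting a label \<open>s\<close> in all possible ways into the sum of all
  words of content \<open>M\<close>, with weight \<open>b\<close> to the number of equal labels passed, gives the sum of all
  words of content \<open>M + s\<close>, multiplied by the quantum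
  integer \<open>[k + 1]\<^sub>b\<close>, where \<open>k\<close> is the multiplicity of \<open>s\<close> in \<open>M\<close> (\<open>qsym_step_word_sum\<close>).  So the
  symmetrizer sends a word with \<open>i\<close> labels of one kind and \<open>j\<close> of the other to \<open>[i]\<^sub>b! [j]\<^sub>b!\<close> times
  the sum of all words of the same content (\<open>qsym_word\<close>).

  Hence an element of the tensor algebra is a relation if and only if, for every content with
  \<open>[i]\<^sub>b! [j]\<^sub>b! \<noteq> 0\<close>, its coefficients at the words of this content have sum 0
  (\<open>nichols_ideal_1b1_iff\<close>).  One word for each such content gives a basis of the Nichols algebra
  (\<open>Span_nichols_class_words\<close>, \<open>independent_nichols_class_words\<close>).  As \<open>b \<noteq> 1\<close>, the quantum integer
  \<open>[k]\<^sub>b\<close> vanishes exactly when \<open>b\<^sup>k = 1\<close>.  If \<open>b\<close> has order \<open>n\<close>, these contents are the pairs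
  \<open>i, j < n\<close>, and the dimension is \<open>n\<^sup>2\<close>; if \<open>b\<close> is not a root of unity, all contents occur and the
  dimension is infinite.
\<close>

section \<open>Linear endomorphisms of the tensor algebra\<close>

text \<open>
  Linearity over the ground field, expressed as being determined by the values on the basis of words;
  this form lets two endomorphisms be compared on words only.
\<close>

definition linear_endo :: "(('x list \<Rightarrow>\<^sub>0 'k::field) \<Rightarrow> ('x list \<Rightarrow>\<^sub>0 'k)) \<Rightarrow> bool"
  where "linear_endo F \<longleftrightarrow> (\<forall>p. F p = lin_ext (\<lambda>w. F (word w)) p)"

text \<open>
  To be used with explicit instances: as a rewrite rule the equation applies to its own right-hand side.
\<close>

lemma linear_endo_expand: "linear_endo F \<Longrightarrow> F p = lin_ext (\<lambda>w. F (word w)) p"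
  unfolding linear_endo_def by (rule spec)

lemma linear_endo_lin_ext: "linear_endo (lin_ext f)"
  by (simp add: linear_endo_def lin_ext_word)

lemma linear_endo_ident: "linear_endo (\<lambda>p. p)"
  by (simp add: linear_endo_def lin_ext_ident)

lemma linear_endo_comp:
  assumes "linear_endo F" "linear_endo G"
  shows "linear_endo (\<lambda>p. F (G p))"
  unfolding linear_endo_def
proof
  fix p
  have "F (G p) = lin_ext (\<lambda>w. F (word w)) (lin_ext (\<lambda>w. G (word w)) p)"
    using linear_endo_expand[OF assms(1), of "G p"] linear_endo_expand[OF assms(2), of p] by simp
  also have "\<dots> = lin_ext (\<lambda>w. F (G (word w))) p"
    unfolding lin_ext_lin_ext
    by (rule lin_ext_cong) (rule linear_endo_expand[OF assms(1), symmetric])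
  finally show "F (G p) = lin_ext (\<lambda>w. F (G (word w))) p" .
qed

lemma lin_ext_plus: "lin_ext f p + lin_ext g p = lin_ext (\<lambda>w. f w + g w) p"
  by (simp add: lin_ext_def distrib_left sum.distrib)

lemma linear_endo_add:
  assumes "linear_endo F" "linear_endo G"
  shows "linear_endo (\<lambda>p. F p + G p)"
  unfolding linear_endo_def
proof
  fix p
  show "F p + G p = lin_ext (\<lambda>w. F (word w) + G (word w)) p"
    unfolding lin_ext_plus[symmetric]
    using linear_endo_expand[OF assms(1)] linear_endo_expand[OF assms(2)]
    by (rule arg_cong2[where f = "(+)"])
qed

lemma linear_endo_zero: "linear_endo (\<lambda>p. 0)"
  by (simp add: linear_endo_def lin_ext_def)

lemma linear_endo_sum:
  assumes "\<And>i. i \<in> A \<Longrightarrow> linear_endo (F i)"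
  shows "linear_endo (\<lambda>p. \<Sum>i\<in>A. F i p)"
  using assms
proof (induction A rule: infinite_finite_induct)
  case (insert x A)
  then have "linear_endo (\<lambda>p. F x p + (\<Sum>i\<in>A. F i p))"
    by (intro linear_endo_add) auto
  with insert.hyps show ?case by simp
qed (simp_all add: linear_endo_zero)

lemma linear_endo_mult_right: "linear_endo (\<lambda>p. p * q)"
  unfolding linear_endo_def
proof
  fix p
  have "p * q = lin_ext word p * q"
    by (simp only: lin_ext_ident)
  also have "\<dots> = lin_ext (\<lambda>w. word w * q) p"
    by (simp only: lin_ext_def sum_distrib_right mult.assoc)
  finally show "p * q = lin_ext (\<lambda>w. word w * q) p" .
qed

lemma linear_endo_scalar: "linear_endo (\<lambda>p. scalar a * p)"
  unfolding linear_endo_def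
proof
  fix p
  have "scalar a * p = scalar a * lin_ext word p"
    by (simp only: lin_ext_ident)
  also have "\<dots> = lin_ext (\<lambda>w. scalar a * word w) p"
    by (simp add: lin_ext_def sum_distrib_left scalar_left_scalar mult.commute)
  finally show "scalar a * p = lin_ext (\<lambda>w. scalar a * word w) p" .
qed

lemma mult_scalar_commute: "p * scalar a = scalar a * p"
  using linear_endo_expand[OF linear_endo_mult_right, of p "scalar a"]
    linear_endo_expand[OF linear_endo_scalar, of a p]
  by (simp only: word_scalar)

lemma linear_endo_scalar_apply:
  assumes "linear_endo F"
  shows "F (scalar a * p) = scalar a * F p"
  unfolding linear_endo_expand[OF assms, of p] linear_endo_expand[OF assms, of "scalar a * p"]
  by (rule lin_ext_scalar)

lemma linear_endo_sum_apply:
  assumes "linear_endo F"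
  shows "F (sum g A) = (\<Sum>i\<in>A. F (g i))"
proof -
  have "F (sum g A) = (\<Sum>i\<in>A. lin_ext (\<lambda>w. F (word w)) (g i))"
    unfolding linear_endo_expand[OF assms, of "sum g A"] by (rule lin_ext_sum)
  also have "\<dots> = (\<Sum>i\<in>A. F (g i))"
    by (rule sum.cong[OF refl]) (rule linear_endo_expand[OF assms, symmetric])
  finally show ?thesis .
qed

lemma linear_endo_eq_on_tensor_power:
  assumes "linear_endo F" "linear_endo G" "p \<in> tensor_power n"
    and "\<And>w. length w = n \<Longrightarrow> F (word w) = G (word w)"
  shows "F p = G p"
  unfolding linear_endo_expand[OF assms(1), of p] linear_endo_expand[OF assms(2), of p]
  by (rule lin_ext_cong) (use assms(3,4) in \<open>auto simp: tensor_power_def\<close>)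

lemma linear_endo_braid_at: "linear_endo (braid_at c i)"
  unfolding braid_at_def by (rule linear_endo_lin_ext)

lemma linear_endo_foldr_braid_at: "linear_endo (foldr (braid_at c) is)"
proof (induction "is")
  case (Cons i js)
  show ?case
    using linear_endo_comp[OF linear_endo_braid_at Cons.IH] by (simp add: comp_def)
qed (simp add: linear_endo_ident id_def)

lemma linear_endo_qsym_step: "linear_endo (qsym_step c n)"
proof -
  have "linear_endo (\<lambda>p. p + (\<Sum>i = 1..n. foldr (braid_at c) [i..<Suc n] p))"
    by (intro linear_endo_add linear_endo_sum linear_endo_foldr_braid_at
        linear_endo_ident)
  then show ?thesis by (simp only: qsym_step_def[abs_def])
qed

lemma linear_endo_qsym: "linear_endo (qsym c n)"
proof (cases "(c, n)" rule: qsym.cases)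
  case (3 c n)
  then show ?thesis
    using linear_endo_comp[OF linear_endo_qsym_step linear_endo_lin_ext]
    by (auto simp: comp_def tensor_id_def)
qed (auto simp: linear_endo_ident id_def)

lemma lookup_scalar_mult:
  "Poly_Mapping.lookup (scalar a * p) w = a * Poly_Mapping.lookup p w"
proof -
  have "scalar a * p = Poly_Mapping.map ((*) a) p"
    by (simp add: scalar_def mult_map_scale_conv_mult zero_list_def)
  then show ?thesis
    by (simp add: Poly_Mapping.map.rep_eq when_def)
qed

lemma lookup_word: "Poly_Mapping.lookup (word w) z = (if w = z then 1 else 0)"
  by (simp add: word_def lookup_single when_def)

lemma lookup_lin_ext:
  "Poly_Mapping.lookup (lin_ext f p) z =
    (\<Sum>w\<in>Poly_Mapping.keys p. Poly_Mapping.lookup p w * Poly_Mapping.lookup (f w) z)"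
  by (simp add: lin_ext_def lookup_sum lookup_scalar_mult)

section \<open>Words up to twist\<close>

fun flip :: "gen \<Rightarrow> gen"
  where "flip V1 = V2" | "flip V2 = V1"

lemma flip_flip [simp]: "flip (flip s) = s"
  by (cases s) simp_all

lemma UNIV_gen: "(UNIV :: gen set) = {V1, V2}"
  using gen.exhaust by auto

text \<open>
  The letter at position \<open>n\<close> of a word and its label are obtained from each other by \<open>twist n\<close>.
\<close>

definition twist :: "nat \<Rightarrow> gen \<Rightarrow> gen"
  where "twist n s = (if even n then s else flip s)"

lemma twist_0 [simp]: "twist 0 s = s"
  by (simp add: twist_def)

lemma twist_Suc: "twist (Suc n) s = flip (twist n s)"
  by (simp add: twist_def)

lemma twist_twist [simp]: "twist n (twist n s) = s"
  by (simp add: twist_def)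

text \<open>
  The multiset of labels.  Passing from \<open>w\<close> to \<open>x # w\<close> moves every letter of \<open>w\<close> by one position,
  whence the \<open>flip\<close>.
\<close>

primrec letter_content :: "gen list \<Rightarrow> gen multiset"
  where
    "letter_content [] = {#}"
  | "letter_content (x # w) = add_mset x (image_mset flip (letter_content w))"

lemma size_content [simp]: "size (letter_content w) = length w"
  by (induction w) simp_all

lemma content_append:
  "letter_content (u @ v) =
    letter_content u + image_mset (twist (length u)) (letter_content v)"
  by (induction u) (simp_all add: multiset.map_comp comp_def twist_Suc)

lemma content_snoc: "letter_content (w @ [x]) = add_mset (twist (length w) x) (letter_content w)"
  by (simp add: content_append)

text \<open>
  A word with a given content is built from left to right: appending \<open>twist n s\<close> to a word of length
  \<open>n\<close> adds the label \<open>s\<close>.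
\<close>

lemma content_surj: "\<exists>w. letter_content w = M"
proof (induction M)
  case (add s M)
  then obtain w where "letter_content w = M" ..
  then have "letter_content (w @ [twist (length w) s]) = add_mset s M"
    by (simp add: content_snoc)
  then show ?case ..
qed (auto intro: exI[of _ "[]"])

lemma finite_content: "finite {w. letter_content w = M}"
proof (rule finite_subset)
  show "{w. letter_content w = M} \<subseteq> {w. set w \<subseteq> UNIV \<and> length w = size M}"
    using size_content by auto
  show "finite {w :: gen list. set w \<subseteq> UNIV \<and> length w = size M}"
    by (rule finite_lists_length_eq) (simp add: UNIV_gen)
qed

text \<open>
  The monomials in the quantum shuffle algebra generated by \<open>V\<close> are multiples of these elements, see
  \<open>qsym_word\<close>.
\<close>

definition word_sum :: "gen multiset \<Rightarrow> (gen list \<Rightarrow>\<^sub>0 'k::field)"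
  where "word_sum M = (\<Sum>w | letter_content w = M. word w)"

lemma lookup_word_sum:
  "Poly_Mapping.lookup (word_sum M) w = (if letter_content w = M then 1 else 0)"
  by (simp add: word_sum_def lookup_sum lookup_word finite_content sum.delta')

lemma word_sum_tensor_power: "word_sum M \<in> tensor_power (size M)"
  by (auto simp: tensor_power_def in_keys_iff lookup_word_sum split: if_splits)

lemma word_sum_empty: "word_sum {#} = 1"
proof -
  have "{w. letter_content w = {#}} = {[]}"
    by (auto simp flip: size_eq_0_iff_empty)
  then show ?thesis by (simp add: word_sum_def)
qed

text \<open>
  Splitting off the last letter, of label \<open>t\<close> and at position \<open>n\<close>, makes \<open>qsym_step_word_sum\<close> an
  induction, without an explicit count of shuffles.
\<close>

lemma word_sum_last_letter:
  assumes "size M = Suc n"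
  shows "word_sum M = (\<Sum>t\<in>set_mset M. word_sum (M - {#t#}) * word [twist n t])"
proof -
  have "(\<Sum>t\<in>set_mset M. word_sum (M - {#t#}) * word [twist n t]) =
      (\<Sum>t\<in>set_mset M. \<Sum>u | letter_content u = M - {#t#}. word (u @ [twist n t]))"
    by (simp add: word_sum_def sum_distrib_right word_mult)
  also have "\<dots> = (\<Sum>(t, u)\<in>(SIGMA t : set_mset M. {u. letter_content u = M - {#t#}}).
      word (u @ [twist n t]))"
    by (rule sum.Sigma) (simp_all add: finite_content)
  also have "\<dots> = (\<Sum>w | letter_content w = M. word w)"
  proof (rule sum.reindex_bij_witness[where j = "\<lambda>(t, u). u @ [twist n t]"
        and i = "\<lambda>w. (twist n (last w), butlast w)"])
    fix w assume "w \<in> {w. letter_content w = M}"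
    then have w: "letter_content w = M" by simp
    with assms have "length w = Suc n" by (metis size_content)
    then obtain u x where u: "w = u @ [x]" "length u = n"
      by (metis length_Suc_conv_rev)
    with w show "(twist n (last w), butlast w) \<in>
        (SIGMA t : set_mset M. {u. letter_content u = M - {#t#}})"
      by (auto simp: content_snoc)
    from u show "(case (twist n (last w), butlast w) of (t, u) \<Rightarrow> u @ [twist n t]) = w"
      by simp
  next
    fix a assume a: "a \<in> (SIGMA t : set_mset M. {u. letter_content u = M - {#t#}})"
    then obtain t u where tu: "a = (t, u)" "t \<in># M" "letter_content u = M - {#t#}" by auto
    then have "length u = n"
      using assms size_content[of u] by (simp add: size_Diff_singleton)
    with tu show "(case a of (t, u) \<Rightarrow> u @ [twist n t]) \<in> {w. letter_content w = M}"
      by (simp add: content_snoc)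
  qed auto
  finally show ?thesis unfolding word_sum_def[of M] by (rule sym)
qed

lemma word_sum_single: "word_sum {#s#} = word [s]"
  by (subst word_sum_last_letter[of _ 0]) (simp_all add: word_sum_empty)

section \<open>The quantum symmetrizer\<close>

lemma braiding_1b1_flip:
  "braiding_1b1 b s t = scalar (if s = t then 1 else b) * word [flip t, flip s]"
  by (cases s; cases t) simp_all

text \<open>
  The operators \<open>c\<^sub>i\<close> with \<open>i < m\<close> do not touch the tensor factor \<open>m + 1\<close>.
\<close>

lemma braid_at_mult_letter:
  assumes "p \<in> tensor_power m" "0 < i" "i < m"
  shows "braid_at c i (p * word [y]) = braid_at c i p * word [y]"
proof (rule linear_endo_eq_on_tensor_power[OF _ _ assms(1)])
  show "linear_endo (\<lambda>p. braid_at c i (p * word [y]))"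
    by (rule linear_endo_comp[OF linear_endo_braid_at linear_endo_mult_right])
  show "linear_endo (\<lambda>p. braid_at c i p * word [y])"
    by (rule linear_endo_comp[OF linear_endo_mult_right linear_endo_braid_at])
  fix w :: "'a list" assume "length w = m"
  moreover have "i - Suc 0 < m"
    using assms(3) by simp
  ultimately show "braid_at c i (word w * word [y]) = braid_at c i (word w) * word [y]"
    using assms(3)
    by (simp add: braid_at_def lin_ext_word word_mult nth_append mult.assoc)
qed

lemma tensor_power_scalar_word: "length w = n \<Longrightarrow> scalar a * word w \<in> tensor_power n"
  by (simp add: tensor_power_def scalar_word)

lemma braid_at_1b1_word:
  assumes "length u = n"
  shows "braid_at (braiding_1b1 b) (Suc n) (word (u @ s # t # v)) =
    scalar (if s = t then 1 else b) * word (u @ flip t # flip s # v)"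
  using assms
  by (simp add: braid_at_def lin_ext_word nth_append braiding_1b1_flip word_mult
      word_left_scalar mult.assoc)

lemma braid_at_1b1_preserves_tensor_power:
  assumes "p \<in> tensor_power m" "0 < i" "i < m"
  shows "braid_at (braiding_1b1 b) i p \<in> tensor_power m"
proof -
  have "lin_ext (\<lambda>w. braid_at (braiding_1b1 b) i (word w)) p \<in> tensor_power m"
  proof (rule tensor_power_lin_ext[OF assms(1)])
    fix w :: "gen list" assume w: "length w = m"
    have split: "w = take (i - 1) w @ w ! (i - 1) # w ! i # drop (Suc i) w"
      using w assms(2,3)
      by (metis Cons_nth_drop_Suc One_nat_def Suc_pred append_take_drop_id less_imp_diff_less)
    have len: "length (take (i - 1) w) = i - 1" using w assms by simp
    have i: "Suc (i - 1) = i"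
      using assms(2) by simp
    show "braid_at (braiding_1b1 b) i (word w) \<in> tensor_power m"
      using braid_at_1b1_word[OF len, of b "w ! (i - 1)" "w ! i" "drop (Suc i) w"] w assms(2,3)
      unfolding i split[symmetric] by (simp only:) (rule tensor_power_scalar_word, simp)
  qed
  then show ?thesis by (simp flip: linear_endo_expand[OF linear_endo_braid_at])
qed

lemma foldr_braid_at_mult_letter:
  assumes "p \<in> tensor_power m" "\<forall>i\<in>set is. 0 < i \<and> i < m"
  shows "foldr (braid_at (braiding_1b1 b)) is (p * word [y]) =
      foldr (braid_at (braiding_1b1 b)) is p * word [y]
    \<and> foldr (braid_at (braiding_1b1 b)) is p \<in> tensor_power m"
  using assms(2)
  by (induction "is") (use assms(1) in \<open>auto simp: braid_at_mult_letter
      intro!: braid_at_1b1_preserves_tensor_power\<close>)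

text \<open>
  On words this is the identity \<open>\<SS>\<^sub>n\<^sub>+\<^sub>1\<^sub>,\<^sub>1 = id + (\<SS>\<^sub>n\<^sub>,\<^sub>1 \<otimes> id) c\<^sub>n\<^sub>+\<^sub>1\<close>: every summand but the first applies
  \<open>c\<^sub>n\<^sub>+\<^sub>1\<close> before all else, and what follows leaves the last tensor factor alone.
\<close>

lemma qsym_step_word:
  assumes "length w = n"
  shows "qsym_step (braiding_1b1 b) (Suc n) (word (w @ [s, t])) =
    word (w @ [s, t]) + scalar (if s = t then 1 else b) *
      (qsym_step (braiding_1b1 b) n (word (w @ [flip t])) * word [flip s])"
proof -
  let ?c = "braid_at (braiding_1b1 b)"
  let ?q = "scalar (if s = t then 1 else b)"
  have fold: "foldr ?c [i..<Suc (Suc n)] (word (w @ [s, t])) =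
      ?q * (foldr ?c [i..<Suc n] (word (w @ [flip t])) * word [flip s])"
    if i: "i \<in> {1..Suc n}" for i
  proof -
    have "foldr ?c [i..<Suc (Suc n)] (word (w @ [s, t])) =
        foldr ?c [i..<Suc n] (?c (Suc n) (word (w @ [s, t])))"
      using i by (simp add: upt_Suc)
    also have "?c (Suc n) (word (w @ [s, t])) = ?q * (word (w @ [flip t]) * word [flip s])"
      using braid_at_1b1_word[OF assms, of b s t "[]"] by (simp add: word_mult)
    also have "foldr ?c [i..<Suc n] \<dots> =
        ?q * foldr ?c [i..<Suc n] (word (w @ [flip t]) * word [flip s])"
      by (rule linear_endo_scalar_apply[OF linear_endo_foldr_braid_at])
    also have "foldr ?c [i..<Suc n] (word (w @ [flip t]) * word [flip s]) =
        foldr ?c [i..<Suc n] (word (w @ [flip t])) * word [flip s]"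
      by (rule foldr_braid_at_mult_letter[THEN conjunct1, of _ "Suc n"])
        (use i assms in \<open>auto simp: tensor_power_def word_def\<close>)
    finally show ?thesis .
  qed
  have "qsym_step (braiding_1b1 b) (Suc n) (word (w @ [s, t])) = word (w @ [s, t]) +
      (\<Sum>i = 1..Suc n. ?q * (foldr ?c [i..<Suc n] (word (w @ [flip t])) * word [flip s]))"
    unfolding qsym_step_def using fold by simp
  also have "(\<Sum>i = 1..Suc n. ?q * (foldr ?c [i..<Suc n] (word (w @ [flip t])) * word [flip s])) =
      ?q * (qsym_step (braiding_1b1 b) n (word (w @ [flip t])) * word [flip s])"
    by (simp add: qsym_step_def sum_distrib_left sum_distrib_right distrib_left distrib_right)
  finally show ?thesis .
qed

text \<open>
  The same recursion in terms of the labels \<open>t\<close> and \<open>s\<close> of the last two letters.  The two labels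
  change places, and the factor is now \<open>b\<close> for equal labels: adjacent letters with equal labels are
  different.
\<close>

lemma qsym_step_twisted:
  assumes "p \<in> tensor_power n"
  shows "qsym_step (braiding_1b1 b) (Suc n) (p * word [twist n t] * word [twist (Suc n) s]) =
    p * word [twist n t] * word [twist (Suc n) s] + scalar (if s = t then b else 1) *
      (qsym_step (braiding_1b1 b) n (p * word [twist n s]) * word [twist (Suc n) t])"
proof (rule linear_endo_eq_on_tensor_power[OF _ _ assms])
  let ?step = "qsym_step (braiding_1b1 b)"
  show "linear_endo (\<lambda>p. ?step (Suc n) (p * word [twist n t] * word [twist (Suc n) s]))"
    by (intro linear_endo_comp[OF linear_endo_qsym_step]
        linear_endo_comp[OF linear_endo_mult_right] linear_endo_ident)
  show "linear_endo (\<lambda>p. p * word [twist n t] * word [twist (Suc n) s] +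
      scalar (if s = t then b else 1) * (?step n (p * word [twist n s]) * word [twist (Suc n) t]))"
    by (intro linear_endo_add linear_endo_comp[OF linear_endo_scalar]
        linear_endo_comp[OF linear_endo_qsym_step]
        linear_endo_comp[OF linear_endo_mult_right] linear_endo_ident)
  fix w :: "gen list" assume w: "length w = n"
  have "twist n t = twist (Suc n) s \<longleftrightarrow> s \<noteq> t"
    by (cases s; cases t) (simp_all add: twist_def)
  then show "?step (Suc n) (word w * word [twist n t] * word [twist (Suc n) s]) =
    word w * word [twist n t] * word [twist (Suc n) s] + scalar (if s = t then b else 1) *
      (?step n (word w * word [twist n s]) * word [twist (Suc n) t])"
    using qsym_step_word[OF w, of b "twist n t" "twist (Suc n) s"]
    by (simp add: word_mult twist_Suc if_distrib cong: if_cong)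
qed

text \<open>
  The quantum integer \<open>[k]\<^sub>b\<close>, in a form that is meaningful for all \<open>b\<close>.
\<close>

definition qnum :: "'k::field \<Rightarrow> nat \<Rightarrow> 'k"
  where "qnum b k = (\<Sum>i<k. b ^ i)"

lemma qnum_Suc: "qnum b (Suc k) = 1 + b * qnum b k"
  by (simp only: qnum_def sum.lessThan_Suc_shift) (simp add: sum_distrib_left)

text \<open>
  Induction on the size of \<open>M\<close>.  Split \<open>word_sum M\<close> by the last label \<open>t\<close>, and let \<open>k\<close> be the
  multiplicity of \<open>s\<close> in \<open>M\<close>.  By \<open>qsym_step_twisted\<close> and the induction hypothesis, the step operator
  yields \<open>word_sum M\<close> followed by \<open>s\<close>, and for each \<open>t\<close> a multiple of the sum of the words of content
  \<open>M + s\<close> with last label \<open>t\<close>.  The multiple is \<open>[k + 1]\<close> for \<open>t \<noteq> s\<close>.  For \<open>t = s\<close> it is \<open>b [k]\<close>,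
  because one \<open>s\<close> has been split off; together with the first term it becomes \<open>1 + b [k] = [k + 1]\<close> as
  well.
\<close>

lemma qsym_step_word_sum:
  assumes "size M = n"
  shows "qsym_step (braiding_1b1 b) n (word_sum M * word [twist n s]) =
    scalar (qnum b (Suc (count M s))) * word_sum (add_mset s M)"
  using assms
proof (induction n arbitrary: M)
  case 0
  then have "M = {#}" by simp
  then show ?case
    by (simp add: qsym_step_def word_sum_empty word_sum_single qnum_def)
next
  case (Suc n)
  let ?step = "qsym_step (braiding_1b1 b)"
  let ?y = "word [twist (Suc n) s]"
  let ?z = "\<lambda>t. word [twist (Suc n) t]"
  let ?k = "count M s"
  have sz: "size (M - {#t#}) = n" if "t \<in># M" for t
    using that Suc.prems by (simp add: size_Diff_singleton)
  have step: "?step (Suc n) (word_sum (M - {#t#}) * word [twist n t] * ?y) =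
      word_sum (M - {#t#}) * word [twist n t] * ?y +
      (if s = t then scalar (b * qnum b ?k) * (word_sum M * ?y)
       else scalar (qnum b (Suc ?k)) * (word_sum (add_mset s M - {#t#}) * ?z t))"
    if t: "t \<in># M" for t
  proof -
    have "word_sum (M - {#t#}) \<in> tensor_power n"
      using word_sum_tensor_power[of "M - {#t#}"] sz[OF t] by simp
    note qsym_step_twisted[OF this, of b t s]
    moreover have "Suc (count (M - {#s#}) s) = ?k" if "s = t"
      using t that by (simp add: Suc_diff_le)
    ultimately show ?thesis
      using t Suc.IH[OF sz[OF t]]
      by (auto simp: scalar_left_scalar mult.assoc[symmetric] scalar_mult)
  qed
  have expand: "word_sum M * ?y =
      (\<Sum>t\<in>set_mset M. word_sum (M - {#t#}) * word [twist n t] * ?y)"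
    by (simp only: word_sum_last_letter[OF Suc.prems] sum_distrib_right)
  have "?step (Suc n) (word_sum M * ?y) =
      (\<Sum>t\<in>set_mset M. ?step (Suc n) (word_sum (M - {#t#}) * word [twist n t] * ?y))"
    unfolding expand by (rule linear_endo_sum_apply[OF linear_endo_qsym_step])
  also have "\<dots> = word_sum M * ?y +
      (\<Sum>t\<in>set_mset M. if s = t then scalar (b * qnum b ?k) * (word_sum M * ?y)
       else scalar (qnum b (Suc ?k)) * (word_sum (add_mset s M - {#t#}) * ?z t))"
    by (subst expand, subst sum.distrib[symmetric]) (rule sum.cong[OF refl step])
  also have "(\<Sum>t\<in>set_mset M. if s = t then scalar (b * qnum b ?k) * (word_sum M * ?y)
       else scalar (qnum b (Suc ?k)) * (word_sum (add_mset s M - {#t#}) * ?z t)) =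
     scalar (b * qnum b ?k) * (word_sum M * ?y) + (\<Sum>t\<in>set_mset M - {s}.
       scalar (qnum b (Suc ?k)) * (word_sum (add_mset s M - {#t#}) * ?z t))"
  (* If s does not occur in M, then k = 0 and the coefficient b [k] of the new summand vanishes. *)
  proof (cases "s \<in># M")
    case True
    show ?thesis
      unfolding sum.remove[OF finite_set_mset True]
      by (intro arg_cong2[where f = "(+)"] sum.cong refl if_P if_not_P) auto
  next
    case False
    then have "qnum b ?k = 0" and minus: "set_mset M - {s} = set_mset M"
      by (simp_all add: not_in_iff qnum_def)
    then have "scalar (b * qnum b ?k) * (word_sum M * ?y) = 0" by simp
    then show ?thesis
      unfolding minus
      by (simp only: add_0_left) (intro sum.cong refl if_not_P, use False in auto)
  qed
  also have "word_sum M * ?y + (scalar (b * qnum b ?k) * (word_sum M * ?y) +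
      (\<Sum>t\<in>set_mset M - {s}.
        scalar (qnum b (Suc ?k)) * (word_sum (add_mset s M - {#t#}) * ?z t))) =
    scalar (qnum b (Suc ?k)) * (word_sum M * ?y +
      (\<Sum>t\<in>set_mset M - {s}. word_sum (add_mset s M - {#t#}) * ?z t))"
    by (simp add: qnum_Suc scalar_add distrib_left distrib_right sum_distrib_left)
  also have "word_sum M * ?y + (\<Sum>t\<in>set_mset M - {s}. word_sum (add_mset s M - {#t#}) * ?z t) =
      word_sum (add_mset s M)"
    using Suc.prems
    by (subst word_sum_last_letter[of "add_mset s M" "Suc n"]) (simp_all add: sum.insert_remove)
  finally show ?case .
qed

definition qfact :: "'k::field \<Rightarrow> nat \<Rightarrow> 'k"
  where "qfact b k = (\<Prod>j = 1..k. qnum b j)"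

definition content_qfact :: "'k::field \<Rightarrow> gen multiset \<Rightarrow> 'k"
  where "content_qfact b M = qfact b (count M V1) * qfact b (count M V2)"

lemma content_qfact_add_mset:
  "content_qfact b (add_mset s M) = content_qfact b M * qnum b (Suc (count M s))"
  by (cases s) (simp_all add: content_qfact_def qfact_def)

text \<open>
  From degree 0 to degree 1 this holds because all symmetrizers involved are the identity; so
  \<open>qsym_word\<close> can be proved by one induction that starts at the empty word.
\<close>

lemma qsym_Suc_word:
  assumes "length w = n"
  shows "qsym c (Suc n) (word (w @ [x])) = qsym_step c n (qsym c n (word w) * word [x])"
  using assms
  by (cases n) (simp_all add: qsym_step_def tensor_id_def lin_ext_word)

text \<open>
  Appending a letter with label \<open>s\<close> multiplies the factor by \<open>[k + 1]\<close>, by \<open>qsym_step_word_sum\<close>; this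
  is also the change of the product of quantum factorials.
\<close>

proposition qsym_word:
  "qsym (braiding_1b1 b) (length w) (word w) =
    scalar (content_qfact b (letter_content w)) * word_sum (letter_content w)"
proof (induction w rule: rev_induct)
  case Nil
  show ?case by (simp add: word_sum_empty content_qfact_def qfact_def)
next
  case (snoc x w)
  let ?n = "length w"
  have "qsym (braiding_1b1 b) (Suc ?n) (word (w @ [x])) =
      qsym_step (braiding_1b1 b) ?n
        (scalar (content_qfact b (letter_content w)) * (word_sum (letter_content w) * word [x]))"
    by (simp add: qsym_Suc_word snoc.IH mult.assoc)
  also have "\<dots> = scalar (content_qfact b (letter_content w)) *
      qsym_step (braiding_1b1 b) ?n (word_sum (letter_content w) * word [twist ?n (twist ?n x)])"
    by (simp add: linear_endo_scalar_apply[OF linear_endo_qsym_step])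
  also have "\<dots> = scalar (content_qfact b (letter_content (w @ [x]))) * word_sum (letter_content (w @ [x]))"
    by (subst qsym_step_word_sum)
      (simp_all add: scalar_left_scalar content_snoc content_qfact_add_mset)
  finally show ?case by simp
qed

section \<open>The ideal of relations\<close>

text \<open>
  These linear forms describe the ideal of relations, see \<open>nichols_ideal_1b1_iff\<close>.
\<close>

definition content_coeff :: "gen multiset \<Rightarrow> (gen list \<Rightarrow>\<^sub>0 'k::field) \<Rightarrow> 'k"
  where "content_coeff M p = (\<Sum>w | letter_content w = M. Poly_Mapping.lookup p w)"

lemma content_coeff_0 [simp]: "content_coeff M 0 = 0"
  by (simp add: content_coeff_def)

lemma content_coeff_add: "content_coeff M (p + q) = content_coeff M p + content_coeff M q"
  by (simp add: content_coeff_def lookup_add sum.distrib)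

lemma content_coeff_diff: "content_coeff M (p - q) = content_coeff M p - content_coeff M q"
  by (simp add: content_coeff_def lookup_minus sum_subtractf)

lemma content_coeff_sum: "content_coeff M (sum f A) = (\<Sum>i\<in>A. content_coeff M (f i))"
  by (induction A rule: infinite_finite_induct) (simp_all add: content_coeff_add)

lemma content_coeff_scalar: "content_coeff M (scalar a * p) = a * content_coeff M p"
  by (simp add: content_coeff_def lookup_scalar_mult sum_distrib_left)

lemma content_coeff_word:
  "content_coeff M (word w) = (if letter_content w = M then 1 else 0)"
  by (simp add: content_coeff_def lookup_word finite_content)

lemma content_coeff_lin_ext:
  "content_coeff M (lin_ext f p) =
    (\<Sum>w\<in>Poly_Mapping.keys p. Poly_Mapping.lookup p w * content_coeff M (f w))"
  by (simp add: lin_ext_def content_coeff_sum content_coeff_scalar)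

lemma content_coeff_keys:
  "content_coeff M p =
    (\<Sum>w\<in>Poly_Mapping.keys p. Poly_Mapping.lookup p w * (if letter_content w = M then 1 else 0))"
  using content_coeff_lin_ext[of M word p] by (simp only: lin_ext_ident content_coeff_word)

lemma lookup_qsym_homog_part:
  "Poly_Mapping.lookup (qsym (braiding_1b1 b) n (homog_part n p)) z =
    (if length z = n
     then content_qfact b (letter_content z) * content_coeff (letter_content z) p else 0)"
proof -
  let ?S = "qsym (braiding_1b1 b) n"
  have "?S (homog_part n p) = lin_ext (\<lambda>w. ?S (homog_part n (word w))) p"
    unfolding homog_part_def
    by (rule linear_endo_expand, rule linear_endo_comp[OF linear_endo_qsym linear_endo_lin_ext])
  then have lookup: "Poly_Mapping.lookup (?S (homog_part n p)) z = (\<Sum>w\<in>Poly_Mapping.keys p.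
      Poly_Mapping.lookup p w * Poly_Mapping.lookup (?S (homog_part n (word w))) z)"
    by (simp only: lookup_lin_ext)
  have "?S 0 = 0"
    using linear_endo_scalar_apply[OF linear_endo_qsym, of "braiding_1b1 b" n 0 0] by simp
  then have summand: "Poly_Mapping.lookup (?S (homog_part n (word w))) z =
      (if length z = n then content_qfact b (letter_content z) *
        (if letter_content w = letter_content z then 1 else 0) else 0)" for w
  proof (cases "letter_content w = letter_content z")
    case True
    then have "length w = length z" by (metis size_content)
    with True \<open>?S 0 = 0\<close> show ?thesis
      using qsym_word[of b w]
      by (auto simp: homog_part_def lin_ext_word lookup_scalar_mult lookup_word_sum)
  next
    case False
    with \<open>?S 0 = 0\<close> show ?thesis
      using qsym_word[of b w]
      by (auto simp: homog_part_def lin_ext_word lookup_scalar_mult lookup_word_sum)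
  qed
  show ?thesis
    unfolding lookup content_coeff_keys[of _ p] summand
    by (simp add: sum_distrib_left mult_ac)
qed

text \<open>
  By \<open>qsym_word\<close>, the symmetrizer maps a homogeneous element to a combination of the elements
  \<open>word_sum M\<close>, with coefficients \<open>content_qfact b M * content_coeff M p\<close>.  Different \<open>M\<close> involve
  different words, so that each coefficient has to vanish.
\<close>

proposition nichols_ideal_1b1_iff:
  "p \<in> nichols_ideal (braiding_1b1 b) \<longleftrightarrow>
    (\<forall>M. content_qfact b M \<noteq> 0 \<longrightarrow> content_coeff M p = 0)"
proof -
  have "p \<in> nichols_ideal (braiding_1b1 b) \<longleftrightarrow>
      (\<forall>z. content_qfact b (letter_content z) * content_coeff (letter_content z) p = 0)"
    by (auto simp: nichols_ideal_def poly_mapping_eq_iff fun_eq_iff lookup_qsym_homog_part)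
  also have "\<dots> \<longleftrightarrow> (\<forall>M. content_qfact b M * content_coeff M p = 0)"
    by (metis content_surj)
  finally show ?thesis by auto
qed

lemma qfact_nonzero_iff: "qfact b k \<noteq> 0 \<longleftrightarrow> (\<forall>j. 0 < j \<and> j \<le> k \<longrightarrow> qnum b j \<noteq> 0)"
  by (auto simp: qfact_def Suc_le_eq)

text \<open>
  With \<open>content_qfact_twist\<close>, this makes the ideal of relations absorb products: cutting a factor off a
  word leaves a smaller content, possibly with the labels exchanged.
\<close>

lemma content_qfact_subset:
  assumes "M \<subseteq># N" "content_qfact b N \<noteq> 0"
  shows "content_qfact b M \<noteq> 0"
proof -
  have "qfact b (count M s) \<noteq> 0" if "qfact b (count N s) \<noteq> 0" for s
    using that mset_subset_eq_count[OF assms(1), of s] unfolding qfact_nonzero_iff by fastforce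
  with assms(2) show ?thesis
    by (simp add: content_qfact_def)
qed

lemma content_qfact_twist: "content_qfact b (image_mset (twist n) M) = content_qfact b M"
proof -
  have "count (image_mset flip M) s = count M (flip s)" for s
  proof (induction M)
    case (add x M)
    then show ?case by (cases x; cases s) simp_all
  qed simp
  then have "content_qfact b (image_mset flip M) = content_qfact b M"
    by (simp add: content_qfact_def)
  then show ?thesis
    by (cases "even n") (simp_all add: twist_def[abs_def])
qed

lemma image_twist_twist [simp]: "image_mset (twist n) (image_mset (twist n) M) = M"
  by (simp add: multiset.map_comp comp_def)

lemma content_coeff_word_mult:
  "content_coeff M (word u * p) =
    (if letter_content u \<subseteq># M
     then content_coeff (image_mset (twist (length u)) (M - letter_content u)) p else 0)"
proof -
  let ?N = "image_mset (twist (length u)) (M - letter_content u)"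
  have "letter_content (u @ w) = M \<longleftrightarrow> letter_content u \<subseteq># M \<and> letter_content w = ?N" for w
    unfolding content_append
    by (metis add_diff_cancel_left' image_twist_twist mset_subset_eq_add_left
        subset_mset.add_diff_inverse)
  moreover have "word u * p = lin_ext (\<lambda>w. word (u @ w)) p"
  proof -
    have "word u * p = word u * lin_ext word p"
      by (simp only: lin_ext_ident)
    then show ?thesis
      by (simp add: lin_ext_def sum_distrib_left word_left_scalar word_mult)
  qed
  ultimately show ?thesis
    by (simp add: content_coeff_lin_ext content_coeff_word content_coeff_keys[of _ p])
qed

text \<open>
  The labels of \<open>v\<close> in \<open>w @ v\<close> depend on the length of \<open>w\<close>, but among the words \<open>w @ v\<close> of content \<open>M\<close>
  this length is always the size of \<open>M\<close> minus the length of \<open>v\<close>.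
\<close>

lemma content_coeff_mult_word:
  "\<exists>N. content_coeff M (p * word v) = 0 \<or>
    (N \<subseteq># M \<and> content_coeff M (p * word v) = content_coeff N p)"
proof -
  let ?D = "image_mset (twist (size M - length v)) (letter_content v)"
  have content: "letter_content (w @ v) = M \<longleftrightarrow> ?D \<subseteq># M \<and> letter_content w = M - ?D" for w
  proof
    assume M: "letter_content (w @ v) = M"
    then have "size M = length w + length v"
      by (metis length_append size_content)
    with M have "letter_content w + ?D = M"
      by (simp add: content_append)
    then show "?D \<subseteq># M \<and> letter_content w = M - ?D"
      using mset_subset_eq_add_right[of ?D "letter_content w"] add_diff_cancel_right' by metis
  next
    assume a: "?D \<subseteq># M \<and> letter_content w = M - ?D"
    then have "length w = size M - length v"
      by (metis size_Diff_submset size_content size_image_mset)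
    with a show "letter_content (w @ v) = M"
      by (simp add: content_append)
  qed
  have "content_coeff M (p * word v) =
      (\<Sum>w\<in>Poly_Mapping.keys p. Poly_Mapping.lookup p w * content_coeff M (word w * word v))"
    using linear_endo_expand[OF linear_endo_mult_right, of p "word v"]
      content_coeff_lin_ext[of M "\<lambda>w. word w * word v" p] by simp
  then have "content_coeff M (p * word v) = (if ?D \<subseteq># M then content_coeff (M - ?D) p else 0)"
    by (simp add: word_mult content_coeff_word content content_coeff_keys[of _ p])
  then show ?thesis
    by (metis diff_subset_eq_self)
qed

lemma nichols_ideal_mult:
  assumes "p \<in> nichols_ideal (braiding_1b1 b)"
  shows "q * p \<in> nichols_ideal (braiding_1b1 b)" and "p * q \<in> nichols_ideal (braiding_1b1 b)"
proof -
  have zero: "content_coeff M p = 0" if "content_qfact b M \<noteq> 0" for M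
    using assms that by (simp add: nichols_ideal_1b1_iff)
  have left: "content_coeff M (word u * p) = 0" if "content_qfact b M \<noteq> 0" for M u
    unfolding content_coeff_word_mult
    using zero content_qfact_subset[OF diff_subset_eq_self that] by (simp add: content_qfact_twist)
  have right: "content_coeff M (p * word u) = 0" if "content_qfact b M \<noteq> 0" for M u
    using content_coeff_mult_word[of M p u] zero content_qfact_subset[OF _ that] by metis
  have q: "q = (\<Sum>w\<in>Poly_Mapping.keys q. scalar (Poly_Mapping.lookup q w) * word w)"
    using lin_ext_ident[of q] by (simp add: lin_ext_def)
  have "content_coeff M (q * p) = 0" if "content_qfact b M \<noteq> 0" for M
    by (subst q) (simp add: sum_distrib_right content_coeff_sum mult.assoc content_coeff_scalar
        left[OF that])
  then show "q * p \<in> nichols_ideal (braiding_1b1 b)"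
    by (simp add: nichols_ideal_1b1_iff)
  have comm: "p * (scalar a * word w) = scalar a * (p * word w)" for a w
    by (simp flip: mult.assoc add: mult_scalar_commute)
  have "content_coeff M (p * q) = 0" if "content_qfact b M \<noteq> 0" for M
    by (subst q) (simp add: sum_distrib_left content_coeff_sum comm content_coeff_scalar
        right[OF that])
  then show "p * q \<in> nichols_ideal (braiding_1b1 b)"
    by (simp add: nichols_ideal_1b1_iff)
qed

lemma tensor_algebra_simps [simp]:
  "carrier ring_of_type_algebra = UNIV"
  "x \<oplus>\<^bsub>ring_of_type_algebra\<^esub> y = x + y"
  "x \<otimes>\<^bsub>ring_of_type_algebra\<^esub> y = x * y"
  "\<one>\<^bsub>ring_of_type_algebra\<^esub> = 1"
  "\<zero>\<^bsub>ring_of_type_algebra\<^esub> = 0"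
  by (simp_all add: ring_of_type_algebra_def)

lemma ideal_nichols_ideal: "ideal (nichols_ideal (braiding_1b1 b)) ring_of_type_algebra"
proof -
  let ?R = "ring_of_type_algebra :: (gen list \<Rightarrow>\<^sub>0 'a) ring"
  interpret R: ring ?R
    by (rule ring_tensor_algebra)
  show ?thesis
  proof (rule idealI[OF ring_tensor_algebra])
    show "subgroup (nichols_ideal (braiding_1b1 b)) (add_monoid ?R)"
    proof (rule R.add.subgroupI)
      fix p assume p: "p \<in> nichols_ideal (braiding_1b1 b)"
      have "\<ominus>\<^bsub>?R\<^esub> p = - p"
        by (rule R.minus_equality) simp_all
      then show "\<ominus>\<^bsub>?R\<^esub> p \<in> nichols_ideal (braiding_1b1 b)"
        using p content_coeff_diff[of _ 0 p] by (simp add: nichols_ideal_1b1_iff)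
    next
      show "nichols_ideal (braiding_1b1 b) \<noteq> {}"
        using nichols_ideal_1b1_iff[of 0 b] by auto
    qed (simp_all add: nichols_ideal_1b1_iff content_coeff_add)
  qed (simp_all add: nichols_ideal_mult)
qed

section \<open>A basis of the Nichols algebra\<close>

definition nichols_class :: "'k::field \<Rightarrow> (gen list \<Rightarrow>\<^sub>0 'k) \<Rightarrow> (gen list \<Rightarrow>\<^sub>0 'k) set"
  where "nichols_class b p = nichols_ideal (braiding_1b1 b) +>\<^bsub>ring_of_type_algebra\<^esub> p"

lemma ring_hom_nichols_class:
  "ring_hom_ring ring_of_type_algebra (nichols_algebra (braiding_1b1 b)) (nichols_class b)"
  using ideal.rcos_ring_hom_ring[OF ideal_nichols_ideal]
  unfolding nichols_algebra_def nichols_class_def[abs_def] .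

lemma ring_nichols_algebra: "ring (nichols_algebra (braiding_1b1 b))"
  using ring_hom_nichols_class by (rule ring_hom_ring.axioms)

lemma carrier_nichols_algebra:
  "carrier (nichols_algebra (braiding_1b1 b)) = range (nichols_class b)"
  by (auto simp: nichols_algebra_def FactRing_def A_RCOSETS_def' nichols_class_def)

text \<open>
  The forms \<open>content_coeff M\<close> with nonzero quantum factorial descend to the Nichols algebra and separate
  its elements.
\<close>

lemma nichols_class_eq_iff:
  "nichols_class b p = nichols_class b q \<longleftrightarrow>
    (\<forall>M. content_qfact b M \<noteq> 0 \<longrightarrow> content_coeff M p = content_coeff M q)"
proof -
  have mem: "r \<in> nichols_class b s \<longleftrightarrow>
      (\<forall>M. content_qfact b M \<noteq> 0 \<longrightarrow> content_coeff M r = content_coeff M s)" for r s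
  proof -
    have "r \<in> nichols_class b s \<longleftrightarrow> r - s \<in> nichols_ideal (braiding_1b1 b)"
      unfolding nichols_class_def a_r_coset_def' by (auto intro: bexI[of _ "r - s"])
    then show ?thesis
      by (simp add: nichols_ideal_1b1_iff content_coeff_diff)
  qed
  show ?thesis
  proof
    assume "nichols_class b p = nichols_class b q"
    moreover have "p \<in> nichols_class b p" by (simp add: mem)
    ultimately show "\<forall>M. content_qfact b M \<noteq> 0 \<longrightarrow> content_coeff M p = content_coeff M q"
      by (simp add: mem)
  qed (auto simp: mem)
qed

lemma ring_hom_scalar:
  "ring_hom_ring ring_of_type_algebra (ring_of_type_algebra :: ('x list \<Rightarrow>\<^sub>0 'k::field) ring) scalar"
  by (intro ring_hom_ringI2 ring_from_type_algebra ring_tensor_algebra ring_hom_memI)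
    (simp_all add: scalar_mult scalar_add)

text \<open>
  The ground field maps to the Nichols algebra by a ring homomorphism, and the target is not zero: 1 is
  not a relation, since \<open>content_coeff {#}\<close> takes the value 1 on it.
\<close>

lemma subfield_nichols_scalars:
  "subfield (nichols_scalars (braiding_1b1 b)) (nichols_algebra (braiding_1b1 b))"
proof -
  let ?k = "ring_of_type_algebra :: 'a ring"
  let ?Q = "nichols_algebra (braiding_1b1 b)"
  interpret k: field ?k
    by (rule field_from_type_algebra)
  interpret cls: ring_hom_ring "ring_of_type_algebra" ?Q "nichols_class b"
    by (rule ring_hom_nichols_class)
  interpret scalars: ring_hom_ring ?k ?Q "nichols_class b \<circ> scalar"
    by (intro ring_hom_ringI2 k.ring_axioms cls.S.ring_axioms
        ring_hom_trans[OF ring_hom_ring.homh[OF ring_hom_scalar] cls.homh])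
  have "content_coeff {#} (1 :: gen list \<Rightarrow>\<^sub>0 'a) = 1"
    using content_coeff_word[of "{#}" "[]"] by simp
  then have "nichols_class b 1 \<noteq> nichols_class b 0"
    by (auto simp: nichols_class_eq_iff content_qfact_def qfact_def intro!: exI[of _ "{#}"])
  then have "\<one>\<^bsub>?Q\<^esub> \<noteq> \<zero>\<^bsub>?Q\<^esub>"
    using cls.hom_one cls.hom_zero by simp
  from scalars.img_is_subfield(2)[OF k.carrier_is_subfield this]
  show ?thesis
    by (simp add: nichols_scalars_def nichols_class_def image_comp[symmetric] image_image comp_def)
qed

text \<open>
  By induction on the list: subtracting \<open>content_coeff (letter_content w) p\<close> times the word \<open>w\<close> from \<open>p\<close>
  makes the form for the content of \<open>w\<close> vanish and changes no other one.
\<close>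

lemma Span_nichols_class_words:
  "ring.Span (nichols_algebra (braiding_1b1 b)) (nichols_scalars (braiding_1b1 b))
      (map (\<lambda>w. nichols_class b (word w)) ws) =
    nichols_class b `
      {p. \<forall>M. content_qfact b M \<noteq> 0 \<longrightarrow> M \<notin> letter_content ` set ws \<longrightarrow> content_coeff M p = 0}"
  (is "?Span ws = _ ` ?P ws")
proof -
  let ?Q = "nichols_algebra (braiding_1b1 b)"
  let ?K = "nichols_scalars (braiding_1b1 b)"
  interpret cls: ring_hom_ring "ring_of_type_algebra" ?Q "nichols_class b"
    by (rule ring_hom_nichols_class)
  have K: "?K = range (\<lambda>a. nichols_class b (scalar a))"
    by (simp add: nichols_scalars_def nichols_class_def)
  show ?thesis
  proof (induction ws)
    case Nil
    have "nichols_class b ` ?P [] = {nichols_class b 0}"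
    proof -
      have "nichols_class b p = nichols_class b 0" if "p \<in> ?P []" for p
        unfolding nichols_class_eq_iff using that by simp
      moreover have "0 \<in> ?P []" by simp
      ultimately show ?thesis by blast
    qed
    then show ?case
      using cls.hom_zero by simp
  next
    case (Cons w ws)
    have comb: "nichols_class b (scalar a) \<otimes>\<^bsub>?Q\<^esub> nichols_class b (word w)
        \<oplus>\<^bsub>?Q\<^esub> nichols_class b p = nichols_class b (scalar a * word w + p)" for a p
      using cls.hom_mult[of "scalar a" "word w"] cls.hom_add[of "scalar a * word w" p] by simp
    have Span_Cons:
        "?Span (w # ws) = cls.S.line_extension ?K (nichols_class b (word w)) (?Span ws)"
      by simp
    have ext: "u \<in> ?Span (w # ws) \<longleftrightarrow>
        (\<exists>a. \<exists>p\<in>?P ws. u = nichols_class b (scalar a * word w + p))" for u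
      unfolding Span_Cons cls.S.line_extension_mem_iff Cons.IH by (simp add: K comb)
    show ?case
    proof (rule equalityI; rule subsetI)
      fix u assume "u \<in> ?Span (w # ws)"
      then obtain a p where "p \<in> ?P ws" "u = nichols_class b (scalar a * word w + p)"
        using ext by blast
      then show "u \<in> nichols_class b ` ?P (w # ws)"
        by (auto intro!: imageI simp: content_coeff_add content_coeff_scalar content_coeff_word)
    next
      fix u assume "u \<in> nichols_class b ` ?P (w # ws)"
      then obtain p where p: "p \<in> ?P (w # ws)" "u = nichols_class b p" by blast
      let ?a = "content_coeff (letter_content w) p"
      have "p - scalar ?a * word w \<in> ?P ws"
        using p(1) by (auto simp: content_coeff_diff content_coeff_scalar content_coeff_word)
      moreover have "u = nichols_class b (scalar ?a * word w + (p - scalar ?a * word w))"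
        using p(2) by simp
      ultimately show "u \<in> ?Span (w # ws)"
        using ext by blast
    qed
  qed
qed

text \<open>
  On the span of the words in \<open>ws\<close> the form for any other content with nonzero quantum factorial
  vanishes, while it takes the value 1 on a word of that content.
\<close>

lemma independent_nichols_class_words:
  assumes "distinct (map letter_content ws)"
    and "\<forall>w\<in>set ws. content_qfact b (letter_content w) \<noteq> 0"
  shows "ring.independent (nichols_algebra (braiding_1b1 b)) (nichols_scalars (braiding_1b1 b))
    (map (\<lambda>w. nichols_class b (word w)) ws)"
proof -
  interpret Q: ring "nichols_algebra (braiding_1b1 b)"
    by (rule ring_nichols_algebra)
  show ?thesis
    using assms
  proof (induction ws)
    case (Cons w ws)
    have "nichols_class b (word w) \<notin>
        Q.Span (nichols_scalars (braiding_1b1 b)) (map (\<lambda>w. nichols_class b (word w)) ws)"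
    proof
      assume "nichols_class b (word w) \<in>
        Q.Span (nichols_scalars (braiding_1b1 b)) (map (\<lambda>w. nichols_class b (word w)) ws)"
      then obtain p where "nichols_class b (word w) = nichols_class b p"
        and "\<forall>M. content_qfact b M \<noteq> 0 \<longrightarrow> M \<notin> letter_content ` set ws \<longrightarrow> content_coeff M p = 0"
        unfolding Span_nichols_class_words by blast
      then have "content_coeff (letter_content w) (word w) = (0 :: 'a)"
        using Cons.prems by (simp add: nichols_class_eq_iff)
      then show False by (simp add: content_coeff_word)
    qed
    then show ?case
      using Cons by (auto intro!: Q.li_Cons simp: carrier_nichols_algebra)
  qed simp
qed

definition content_word :: "gen multiset \<Rightarrow> gen list"
  where "content_word M = (SOME w. letter_content w = M)"

lemma letter_content_content_word [simp]: "letter_content (content_word M) = M"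
  unfolding content_word_def by (rule someI_ex) (rule content_surj)

proposition dimension_nichols_algebra:
  assumes "finite {M. content_qfact b M \<noteq> 0}"
  shows "ring.dimension (nichols_algebra (braiding_1b1 b)) (card {M. content_qfact b M \<noteq> 0})
    (nichols_scalars (braiding_1b1 b)) (carrier (nichols_algebra (braiding_1b1 b)))"
proof -
  interpret Q: ring "nichols_algebra (braiding_1b1 b)"
    by (rule ring_nichols_algebra)
  obtain Ms where Ms: "set Ms = {M. content_qfact b M \<noteq> 0}" "distinct Ms"
    using finite_distinct_list[OF assms] by blast
  let ?ws = "map content_word Ms"
  let ?us = "map (\<lambda>w. nichols_class b (word w)) ?ws"
  have contents: "map letter_content ?ws = Ms"
    by (simp add: comp_def)
  have "Q.independent (nichols_scalars (braiding_1b1 b)) ?us"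
    by (rule independent_nichols_class_words) (use Ms contents in auto)
  moreover have "letter_content ` set ?ws = set Ms"
    by (metis contents set_map)
  then have "Q.Span (nichols_scalars (braiding_1b1 b)) ?us =
      carrier (nichols_algebra (braiding_1b1 b))"
    unfolding Span_nichols_class_words carrier_nichols_algebra using Ms(1) by auto
  moreover have "length ?us = card {M. content_qfact b M \<noteq> 0}"
    using Ms distinct_card[of Ms] by simp
  ultimately show ?thesis
    using Q.dimension_independent by metis
qed

text \<open>
  An infinite set of contents would provide independent families of any length.
\<close>

proposition finite_dimension_imp_finite_contents:
  assumes "ring.finite_dimension (nichols_algebra (braiding_1b1 b))
    (nichols_scalars (braiding_1b1 b)) (carrier (nichols_algebra (braiding_1b1 b)))"
  shows "finite {M. content_qfact b M \<noteq> 0}"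
proof (rule ccontr)
  let ?Q = "nichols_algebra (braiding_1b1 b)"
  let ?K = "nichols_scalars (braiding_1b1 b)"
  assume infinite: "infinite {M. content_qfact b M \<noteq> 0}"
  obtain d where d: "ring.dimension ?Q d ?K (carrier ?Q)"
    using assms ring.finite_dimension_def[OF ring_nichols_algebra] by blast
  obtain S where S: "S \<subseteq> {M. content_qfact b M \<noteq> 0}" "finite S" "card S = Suc d"
    using infinite_arbitrarily_large[OF infinite] by blast
  obtain Ms where Ms: "set Ms = S" "distinct Ms"
    using finite_distinct_list[OF S(2)] by blast
  let ?ws = "map content_word Ms"
  have "map letter_content ?ws = Ms"
    by (simp add: comp_def)
  then have "ring.independent ?Q ?K (map (\<lambda>w. nichols_class b (word w)) ?ws)"
    by (intro independent_nichols_class_words) (use S(1) Ms in auto)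
  from ring.independent_length_le_dimension[OF ring_nichols_algebra subfield_nichols_scalars d this]
  have "length Ms \<le> d"
    by (auto simp: carrier_nichols_algebra)
  then show False
    using S(3) Ms distinct_card[of Ms] by simp
qed

section \<open>Roots of unity\<close>

lemma qnum_eq_0_iff:
  assumes "b \<noteq> 1"
  shows "qnum b k = 0 \<longleftrightarrow> b ^ k = 1"
  using assms one_diff_power_eq[of b k] by (auto simp: qnum_def)

lemma content_qfact_nonzero_primitive_root:
  assumes "b \<noteq> 1" "primitive_root_of_unity n b"
  shows "content_qfact b M \<noteq> 0 \<longleftrightarrow> count M V1 < n \<and> count M V2 < n"
proof -
  have "qfact b k \<noteq> 0 \<longleftrightarrow> k < n" for k
    unfolding qfact_nonzero_iff qnum_eq_0_iff[OF assms(1)]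
    using assms(2) unfolding primitive_root_of_unity_def
    by (meson le_less_trans not_less)
  then show ?thesis
    by (simp add: content_qfact_def)
qed

lemma bij_betw_gen_multisets:
  "bij_betw (\<lambda>M. (count M V1, count M V2))
    {M. count M V1 < n \<and> count M V2 < n} ({..<n} \<times> {..<n})"
proof (rule bij_betw_byWitness[where f' = "\<lambda>(i, j). replicate_mset i V1 + replicate_mset j V2"])
  show "\<forall>M\<in>{M. count M V1 < n \<and> count M V2 < n}. (case (count M V1, count M V2) of
      (i, j) \<Rightarrow> replicate_mset i V1 + replicate_mset j V2) = M"
  proof
    fix M
    have "count (replicate_mset (count M V1) V1 + replicate_mset (count M V2) V2) s = count M s" for s
      by (cases s) simp_all
    then show "(case (count M V1, count M V2) of
        (i, j) \<Rightarrow> replicate_mset i V1 + replicate_mset j V2) = M"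
      by (simp add: multiset_eq_iff)
  qed
qed auto

theorem theorem2p13:
  fixes b :: "'k::field"
  assumes "b \<noteq> 0" and "b ^ 2 \<noteq> 1"
  shows "(ring.finite_dimension (nichols_algebra (braiding_1b1 b)) (nichols_scalars (braiding_1b1 b))
            (carrier (nichols_algebra (braiding_1b1 b)))
          \<longleftrightarrow> (\<exists>n\<ge>2. primitive_root_of_unity n b))
       \<and> (\<forall>n\<ge>2. primitive_root_of_unity n b \<longrightarrow>
            ring.dim (nichols_algebra (braiding_1b1 b)) (nichols_scalars (braiding_1b1 b))
              (carrier (nichols_algebra (braiding_1b1 b))) = n ^ 2)"
proof -
  let ?Q = "nichols_algebra (braiding_1b1 b)"
  let ?K = "nichols_scalars (braiding_1b1 b)"
  interpret Q: ring ?Q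
    by (rule ring_nichols_algebra)
  have b: "b \<noteq> 1" using assms(2) by auto
  have dim: "Q.dimension (n ^ 2) ?K (carrier ?Q)" if "primitive_root_of_unity n b" for n
  proof -
    have X: "{M. content_qfact b M \<noteq> 0} = {M. count M V1 < n \<and> count M V2 < n}"
      using content_qfact_nonzero_primitive_root[OF b that] by auto
    have "finite {M. content_qfact b M \<noteq> 0}"
      unfolding X using bij_betw_finite[OF bij_betw_gen_multisets[of n]] by simp
    moreover have "card {M. content_qfact b M \<noteq> 0} = n ^ 2"
      unfolding X using bij_betw_same_card[OF bij_betw_gen_multisets[of n]]
      by (simp add: card_cartesian_product power2_eq_square)
    ultimately show ?thesis
      using dimension_nichols_algebra[of b] by simp
  qed
  have root: "\<exists>n\<ge>2. primitive_root_of_unity n b" if fin: "Q.finite_dimension ?K (carrier ?Q)"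
  proof -
    have "\<exists>k>0. b ^ k = 1"
    proof (rule ccontr)
      assume "\<not> (\<exists>k>0. b ^ k = 1)"
      then have "qfact b k \<noteq> 0" for k
        unfolding qfact_nonzero_iff qnum_eq_0_iff[OF b] by blast
      then have "{M. content_qfact b M \<noteq> 0} = UNIV"
        by (simp add: content_qfact_def)
      moreover have "inj (\<lambda>n. replicate_mset n V1)"
        by (rule injI) (metis size_replicate_mset)
      then have "infinite (UNIV :: gen multiset set)"
        using infinite_super[OF subset_UNIV range_inj_infinite] by blast
      ultimately show False
        using finite_dimension_imp_finite_contents[OF fin] by simp
    qed
    then have ex: "\<exists>k. k > 0 \<and> b ^ k = 1" by blast
    define n where "n = (LEAST k. k > 0 \<and> b ^ k = 1)"
    have n: "n > 0" "b ^ n = 1"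
      using LeastI_ex[OF ex] by (simp_all add: n_def)
    moreover have "b ^ m \<noteq> 1" if "0 < m" "m < n" for m
      using not_less_Least[of m "\<lambda>k. k > 0 \<and> b ^ k = 1"] that by (simp add: n_def)
    ultimately have "primitive_root_of_unity n b"
      by (simp add: primitive_root_of_unity_def)
    moreover have "n \<noteq> 1" using n(2) b by auto
    ultimately show ?thesis using n(1) by (intro exI[of _ n]) auto
  qed
  have "Q.dim ?K (carrier ?Q) = n ^ 2" if "primitive_root_of_unity n b" for n
    using Q.dimI[OF subfield_nichols_scalars dim[OF that]] by (simp add: over_def)
  moreover have "Q.finite_dimension ?K (carrier ?Q)" if "primitive_root_of_unity n b" for n
    using Q.finite_dimensionI[OF dim[OF that]] .
  ultimately show ?thesis
    using root by blast
qed

end
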